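(* Let $D$ be a strong digraph on $n\geq 4$ vertices which is not a directed cycle of length $n$. Suppose that $$\min\{d^+(x)+d^-(y),\ d^-(x)+d^+(y)\}\geq n$$ for every pair of non-adjacent (distinct) vertices $x,y$ of $D$ with a common out-neighbour or a common in-neighbour (i.e. such that there is a vertex $z$ with $xz,yz\in A(D)$, or there is a vertex $z$ with $zx,zy\in A(D)$). Then either $D$ contains a cycle of length $n-1$, or $n$ is even and $D$ is isomorphic to the complete bipartite digraph $K^*_{n/2,n/2}$.
   Context: All digraphs are finite, without loops and without multiple arcs (a pair of opposite arcs $xy$, $yx$ is allowed). For a digraph $D$, $V(D)$ is its vertex set and $A(D)$ its arc set; $xy$ denotes the arc directed from $x$ to $y$. Let $N^+(x)=\{y : xy\in A(D)\}$ be the set of out-neighbours and $N^-(x)=\{y : yx\in A(D)\}$ the set of in-neighbours of $x$; the out-degree is $d^+(x)=|N^+(x)|$ and the in-degree is $d^-(x)=|N^-(x)|$. Two distinct vertices $x,y$ are adjacent if $xy\in A(D)$ or $yx\in A(D)$ (or both), and non-adjacent otherwise. A digraph $D$ is strong (strongly connected) if for every choice of distinct vertices $x,y$ there is a directed path from $x$ to $y$ and a directed path from $y$ to $x$. A cycle of length $m\ge 2$ consists of distinct vertices $x_1,\dots,x_m$ together with the arcs $x_ix_{i+1}$ for $1\le i\le m-1$ and $x_mx_1$; "$D$ is a directed cycle of length $n$" means that $D$ consists exactly of such a cycle on all its $n$ vertices, with no further arcs. The complete bipartite digraph $K^*_{p,q}$ has vertex set partitioned into two sets of cardinalities $p$ and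 $q$, with both arcs $xy$ and $yx$ present whenever $x$ and $y$ lie in different parts, and no other arcs. *)

theory Defs
  imports "Graph_Theory.Graph_Theory"
begin

definition common_out_neighbour :: "('a, 'b) pre_digraph \<Rightarrow> 'a \<Rightarrow> 'a \<Rightarrow> bool" where
  "common_out_neighbour G x y \<longleftrightarrow> (\<exists>z. x \<rightarrow>\<^bsub>G\<^esub> z \<and> y \<rightarrow>\<^bsub>G\<^esub> z)"

definition common_in_neighbour :: "('a, 'b) pre_digraph \<Rightarrow> 'a \<Rightarrow> 'a \<Rightarrow> bool" where
  "common_in_neighbour G x y \<longleftrightarrow> (\<exists>z. z \<rightarrow>\<^bsub>G\<^esub> x \<and> z \<rightarrow>\<^bsub>G\<^esub> y)"

definition adjacent :: "('a, 'b) pre_digraph \<Rightarrow> 'a \<Rightarrow> 'a \<Rightarrow> bool" where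
  "adjacent G x y \<longleftrightarrow> x \<rightarrow>\<^bsub>G\<^esub> y \<or> y \<rightarrow>\<^bsub>G\<^esub> x"

text \<open>
  A cycle \<open>p\<close> of the library is a list of arcs, so \<open>length p\<close> counts both its arcs and its
  (distinct) vertices. In a loop-free digraph every such \<open>p\<close> has length at least 2.
\<close>

definition has_cycle_of_length :: "('a, 'b) pre_digraph \<Rightarrow> nat \<Rightarrow> bool" where
  "has_cycle_of_length G m \<longleftrightarrow> (\<exists>p. pre_digraph.cycle G p \<and> length p = m)"

definition is_directed_cycle :: "('a, 'b) pre_digraph \<Rightarrow> nat \<Rightarrow> bool" where
  "is_directed_cycle G m \<longleftrightarrow>
     (\<exists>p. pre_digraph.cycle G p \<and> length p = m \<and> verts G = tail G ` set p \<and> arcs G = set p)"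

text \<open>
  A concrete \<open>K*\<^sub>p\<^sub>,\<^sub>q\<close>, with the two parts tagged by \<open>Inl\<close> and \<open>Inr\<close>. The lemma below shows that
  it is an instance of the library's predicate \<^const>\<open>complete_bipartite_digraph\<close>.
\<close>

definition bipartite_K :: "nat \<Rightarrow> nat \<Rightarrow> (nat + nat) pair_pre_digraph" where
  "bipartite_K p q =
     \<lparr> pverts = Inl ` {..<p} \<union> Inr ` {..<q},
       parcs = (Inl ` {..<p}) \<times> (Inr ` {..<q}) \<union> (Inr ` {..<q}) \<times> (Inl ` {..<p}) \<rparr>"

lemma complete_bipartite_digraph_bipartite_K:
  "complete_bipartite_digraph p q (with_proj (bipartite_K p q))"
  unfolding complete_bipartite_digraph_pair_def
proof (intro conjI exI)
  show "finite (pverts (bipartite_K p q))"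
    by (simp add: bipartite_K_def)
  show "pverts (bipartite_K p q) = Inl ` {..<p} \<union> Inr ` {..<q}"
    by (simp add: bipartite_K_def)
  show "parcs (bipartite_K p q)
      = (Inl ` {..<p}) \<times> (Inr ` {..<q}) \<union> (Inr ` {..<q}) \<times> (Inl ` {..<p})"
    by (simp add: bipartite_K_def)
qed (auto simp: card_image)

end

theory Submission
  imports Defs
begin

text \<open>
  Let \<open>m\<close> be the largest length of a non-spanning cycle; one exists, because a strong digraph all
  of whose cycles are spanning has no chord on a spanning cycle and is thus a directed cycle. If
  \<open>m\<close> is not \<open>n - 1\<close>, then at least two vertices lie off every cycle \<open>c\<^sub>0, \<dots>, c\<^sub>m\<^sub>-\<^sub>1\<close> of length
  \<open>m\<close>, and no cycle has a length strictly between \<open>m\<close> and \<open>n\<close>. Since inserting a vertex \<open>y\<close> off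
  the cycle between \<open>c\<^sub>i\<close> and \<open>c\<^sub>i\<^sub>+\<^sub>1\<close> gives length \<open>m + 1\<close>, at most one of the arcs \<open>c\<^sub>iy\<close> and
  \<open>yc\<^sub>i\<^sub>+\<^sub>1\<close> is present.

  Call \<open>c\<^sub>i, y, c\<^sub>j\<close> with distinct ends a bypass. If the cycle has none and \<open>c\<^sub>iy\<close> is an arc, then
  \<open>y\<close> has at most one out-neighbour on the cycle, so the degree condition for \<open>y\<close> and \<open>c\<^sub>i\<^sub>+\<^sub>1\<close>,
  which are both dominated by \<open>c\<^sub>i\<close>, fails: hence \<open>c\<^sub>i\<^sub>+\<^sub>1y\<close> is an arc as well, and so on around
  the cycle. (The one way out is \<open>K*\<^sub>2\<^sub>,\<^sub>2\<close>; see \<open>entry_propagates\<close>.) As \<open>y\<close> can be entered from every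
  vertex of the cycle, a path from \<open>y\<close> back to the cycle closes up to a cycle of length
  between \<open>m + 1\<close> and \<open>n - 1\<close>, a contradiction.

  Otherwise take a bypass \<open>c\<^sub>0, y, c\<^sub>g\<^sub>+\<^sub>1\<close> whose gap \<open>c\<^sub>1, \<dots>, c\<^sub>g\<close> is as short as possible. Then
  \<open>y\<close> is adjacent to no vertex of the gap, and the degree condition applies both to \<open>y\<close> and
  \<open>c\<^sub>1\<close>, dominated by \<open>c\<^sub>0\<close>, and to \<open>c\<^sub>g\<close> and \<open>y\<close>, dominating \<open>c\<^sub>g\<^sub>+\<^sub>1\<close>. Add the two inequalities
  \<open>d\<^sup>+(y) + d\<^sup>-(c\<^sub>1) \<ge> n\<close> and \<open>d\<^sup>+(c\<^sub>g) + d\<^sup>-(y) \<ge> n\<close>. Neither \<open>y\<close> nor the path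
  \<open>c\<^sub>1, \<dots>, c\<^sub>g\<close> taken as a whole can be inserted into an arc of the rest of the cycle, and this
  bounds the left-hand side so well that equality must hold everywhere
  (\<open>minimal_bypass_tight\<close>): \<open>n = m + 2\<close>, the other vertex \<open>z\<close> off the cycle satisfies
  \<open>y \<leftrightarrow> z\<close>, \<open>z \<rightarrow> c\<^sub>1\<close> and \<open>c\<^sub>g \<rightarrow> z\<close>, and outside the gap exactly one of \<open>c\<^sub>iy\<close>,
  \<open>yc\<^sub>i\<^sub>+\<^sub>1\<close> is an arc. Detours through \<open>y\<close> and \<open>z\<close> that skip a single vertex of the
  cycle would have length \<open>n - 1\<close>; excluding them forces \<open>g = 1\<close>, and then the adjacency of \<open>y\<close>
  to alternate around the cycle: \<open>y\<close> is joined in both directions to the vertices of even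
  index and \<open>z\<close> to those of odd index. Exchanging \<open>y\<close> with a vertex of odd index, or \<open>z\<close> with
  one of even index, yields other cycles of length \<open>m\<close> with the same property, and together these
  determine the digraph as \<open>K*\<^sub>n\<^sub>/\<^sub>2\<^sub>,\<^sub>n\<^sub>/\<^sub>2\<close>.

  All of this is a statement about the arc relation \<open>E\<close> on the vertex set \<open>V\<close>; digraphs only enter
  at the very end.
\<close>

section \<open>Cycles as lists and as periodic sequences\<close>

definition outdeg :: "('a \<Rightarrow> 'a \<Rightarrow> bool) \<Rightarrow> 'a \<Rightarrow> nat" where
  "outdeg E x = card {v. E x v}"

definition indeg :: "('a \<Rightarrow> 'a \<Rightarrow> bool) \<Rightarrow> 'a \<Rightarrow> nat" where
  "indeg E x = card {v. E v x}"

text \<open>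
  Repeating the first vertex at the end makes the closing arc one of the successive arcs.
\<close>

definition closed_path :: "('a \<Rightarrow> 'a \<Rightarrow> bool) \<Rightarrow> 'a list \<Rightarrow> bool" where
  "closed_path E ws \<longleftrightarrow> ws \<noteq> [] \<and> distinct ws \<and> successively E (ws @ [hd ws])"

text \<open>
  Running around the cycle forever makes indices modulo \<open>m\<close> superfluous: any vertex of the cycle
  can be moved to index \<open>0\<close> by a shift, and every arc or segment of the cycle is a
  window \<open>{a..<b}\<close> of indices.
\<close>

definition cyclic_seq :: "('a \<Rightarrow> 'a \<Rightarrow> bool) \<Rightarrow> nat \<Rightarrow> (nat \<Rightarrow> 'a) \<Rightarrow> bool" where
  "cyclic_seq E m c \<longleftrightarrow>
     0 < m \<and> inj_on c {..<m} \<and> (\<forall>i. c (i + m) = c i) \<and> (\<forall>i. E (c i) (c (Suc i)))"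

definition balanced_complete_bipartite :: "'a set \<Rightarrow> ('a \<Rightarrow> 'a \<Rightarrow> bool) \<Rightarrow> bool" where
  "balanced_complete_bipartite V E \<longleftrightarrow>
     (\<exists>X Y. V = X \<union> Y \<and> X \<inter> Y = {} \<and> card X = card Y \<and>
        (\<forall>u v. E u v \<longleftrightarrow> u \<in> X \<and> v \<in> Y \<or> u \<in> Y \<and> v \<in> X))"

lemma cyclic_seqD:
  assumes "cyclic_seq E m c"
  shows "0 < m" "c (i + m) = c i" "E (c i) (c (Suc i))"
  using assms by (auto simp: cyclic_seq_def)

lemma cyclic_seq_mod:
  assumes "cyclic_seq E m c"
  shows "c (i mod m) = c i"
proof -
  have "c (r + k * m) = c r" for k r
  proof (induction k)
    case (Suc k)
    then show ?case using cyclic_seqD(2)[OF assms, of "r + k * m"] by (simp add: ac_simps)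
  qed simp
  from this[of "i mod m" "i div m"] show ?thesis by simp
qed

lemma cyclic_seq_eq_iff:
  assumes "cyclic_seq E m c"
  shows "c i = c j \<longleftrightarrow> i mod m = j mod m"
proof -
  have "c (i mod m) = c (j mod m) \<longleftrightarrow> i mod m = j mod m"
    using assms by (intro inj_on_eq_iff[of c "{..<m}"]) (auto simp: cyclic_seq_def)
  then show ?thesis by (simp add: cyclic_seq_mod[OF assms])
qed

lemma cyclic_seq_range:
  assumes "cyclic_seq E m c"
  shows "range c = c ` {..<m}"
proof -
  have "c i \<in> c ` {..<m}" for i
    using cyclic_seqD(1)[OF assms] cyclic_seq_mod[OF assms, of i]
    by (metis imageI lessThan_iff mod_less_divisor)
  then show ?thesis by auto
qed

lemma cyclic_seq_card:
  assumes "cyclic_seq E m c"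
  shows "card (range c) = m" "finite (range c)"
  using assms unfolding cyclic_seq_range[OF assms] by (auto simp: cyclic_seq_def card_image)

lemma cyclic_seq_shift:
  assumes "cyclic_seq E m c"
  shows "cyclic_seq E m (\<lambda>i. c (i + k))"
proof -
  have "inj_on (\<lambda>i. c (i + k)) {..<m}"
  proof (rule linorder_inj_onI)
    fix x y assume *: "x < y" "x \<in> {..<m}" "y \<in> {..<m}"
    show "c (x + k) \<noteq> c (y + k)"
    proof
      assume "c (x + k) = c (y + k)"
      then have "(y + k) mod m = (x + k) mod m" by (simp add: cyclic_seq_eq_iff[OF assms])
      then have "m dvd (y + k) - (x + k)" using * by (subst (asm) mod_eq_dvd_iff_nat) auto
      then show False using * by (auto dest: dvd_imp_le)
    qed
  qed auto
  with assms show ?thesis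
    unfolding cyclic_seq_def by (auto simp: ac_simps(1) add.commute[of _ k] simp flip: add.assoc)
qed

lemma cyclic_seq_shift_range:
  assumes "cyclic_seq E m c"
  shows "range (\<lambda>i. c (i + k)) = range c"
proof
  show "range c \<subseteq> range (\<lambda>i. c (i + k))"
  proof
    fix x assume "x \<in> range c"
    then obtain i where i: "x = c i" by auto
    have "k \<le> i + k * m" using cyclic_seqD(1)[OF assms] by (cases m) auto
    then have "c ((i + k * m - k) + k) = c i"
      using cyclic_seq_mod[OF assms] by (metis le_add_diff_inverse2 mod_mult_self1)
    then show "x \<in> range (\<lambda>i. c (i + k))" using i by (metis rangeI)
  qed
qed auto

lemma cyclic_seq_inj_on_window:
  assumes "cyclic_seq E m c"
  shows "inj_on c {a..<a + m}"
proof -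
  have "card (c ` {a..<a + m}) = m"
  proof -
    have "c ` {a..<a + m} = (\<lambda>i. c (i + a)) ` {..<m}"
      using image_image[of c "\<lambda>i. i + a" "{0..<m}"]
      by (simp add: image_add_atLeastLessThan' add.commute lessThan_atLeast0)
    also have "card \<dots> = m"
      using cyclic_seq_shift[OF assms, of a] by (simp add: cyclic_seq_def card_image)
    finally show ?thesis .
  qed
  then show ?thesis by (intro eq_card_imp_inj_on) auto
qed

lemma cyclic_seq_segment:
  assumes "cyclic_seq E m c"
  shows "successively E (map c [a..<b])"
proof (induction b)
  case (Suc b)
  then show ?case
    using cyclic_seqD(3)[OF assms, of "b - 1"]
    by (cases "a < b") (auto simp: successively_append_iff last_map)
qed simp

lemma cyclic_seq_window_eq:
  assumes "cyclic_seq E m c" "c i = c j" "a \<le> i" "i < a + m" "a \<le> j" "j < a + m"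
  shows "i = j"
  using inj_onD[OF cyclic_seq_inj_on_window[OF assms(1), of a] assms(2)] assms(3-) by auto

lemma cyclic_seq_position:
  assumes "cyclic_seq E m c" "v \<in> range c"
  obtains j where "a \<le> j" "j < a + m" "v = c j"
proof -
  have "v \<in> range (\<lambda>i. c (i + a))"
    using cyclic_seq_shift_range[OF assms(1), of a] assms(2) by simp
  then have "v \<in> (\<lambda>i. c (i + a)) ` {..<m}"
    using cyclic_seq_range[OF cyclic_seq_shift[OF assms(1), of a]] by simp
  then obtain i where "i < m" "v = c (i + a)" by auto
  then show ?thesis by (intro that[of "i + a"]) auto
qed

lemma closed_path_imp_cyclic_seq:
  assumes "closed_path E ws"
  obtains c where "cyclic_seq E (length ws) c" "range c = set ws"
proof -
  define c where "c i = ws ! (i mod length ws)" for i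
  have ws: "ws \<noteq> []" "distinct ws" "successively E (ws @ [hd ws])"
    using assms by (auto simp: closed_path_def)
  have inj: "inj_on c {..<length ws}"
    using ws(2) by (auto simp: c_def inj_on_def nth_eq_iff_index_eq)
  have E: "E (c i) (c (Suc i))" for i
  proof -
    define j where "j = i mod length ws"
    have j: "j < length ws" using ws(1) by (simp add: j_def)
    have "E ((ws @ [hd ws]) ! j) ((ws @ [hd ws]) ! Suc j)"
      using ws(3) j by (simp add: successively_conv_nth)
    moreover have "(ws @ [hd ws]) ! j = c i" using j by (simp add: c_def j_def nth_append)
    moreover have "(ws @ [hd ws]) ! Suc j = c (Suc i)"
    proof (cases "Suc j = length ws")
      case True
      then have "Suc i mod length ws = 0" unfolding j_def by (simp add: mod_Suc)
      then show ?thesis using True ws(1) by (simp add: c_def nth_append hd_conv_nth)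
    next
      case False
      then have "Suc i mod length ws = Suc j" unfolding j_def by (simp add: mod_Suc)
      then show ?thesis using False j by (simp add: c_def nth_append)
    qed
    ultimately show ?thesis by simp
  qed
  have "cyclic_seq E (length ws) c"
    using ws(1) inj E by (auto simp: cyclic_seq_def c_def)
  moreover have "range c = set ws"
    unfolding cyclic_seq_range[OF calculation] by (auto simp: c_def set_conv_nth)
  ultimately show ?thesis by (rule that)
qed

text \<open>
  The path \<open>ys\<close> replaces the \<open>g\<close> vertices strictly between \<open>c i\<close> and \<open>c (i + g + 1)\<close>. The
  extreme cases matter: with \<open>g = 0\<close> this is the insertion of \<open>ys\<close> into an arc, with
  \<open>ys = []\<close> a shortcut through a chord.
\<close>

lemma closed_path_bypass:
  assumes c: "cyclic_seq E m c" and "g < m"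
    and ys: "distinct ys" "set ys \<inter> range c = {}" "successively E (c i # ys @ [c (i + g + 1)])"
  obtains ws where "closed_path E ws" "length ws = length ys + m - g"
proof
  define S where "S = map c [i + g + 1..<i + m + 1]"
  have "inj_on c {i + g + 1..<i + m + 1}"
    using cyclic_seq_inj_on_window[OF c, of "i + 1"] by (rule inj_on_subset) auto
  then have d: "distinct S" by (simp add: S_def distinct_map del: upt_Suc)
  have l: "last S = c i"
    using \<open>g < m\<close> cyclic_seqD(2)[OF c, of i] by (simp add: S_def last_map)
  have h: "hd S = c (i + g + 1)"
    using \<open>g < m\<close> by (simp add: S_def upt_conv_Cons del: upt_Suc)
  have ne: "S \<noteq> []" using \<open>g < m\<close> by (simp add: S_def)
  have s: "successively E S" unfolding S_def by (rule cyclic_seq_segment[OF c])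
  have "set S \<subseteq> range c" unfolding S_def by auto
  with ys d have "distinct (S @ ys)" by auto
  moreover have "successively E (S @ ys @ [hd S])"
    using ys(3) s l h ne by (simp add: successively_append_iff[of E S] successively_Cons)
  ultimately show "closed_path E (S @ ys)"
    using ne by (simp add: closed_path_def)
  show "length (S @ ys) = length ys + m - g"
    using \<open>g < m\<close> by (simp add: S_def)
qed

text \<open>
  The vertex \<open>y\<close> bypasses the gap \<open>c 1, \<dots>, c g\<close>, and the gap goes as a whole between \<open>c i\<close> and
  \<open>c (i + 1)\<close>, so that nothing is lost and \<open>y\<close> is gained.
\<close>

lemma closed_path_reinsert_gap:
  assumes c: "cyclic_seq E m c" and y: "y \<notin> range c"
    and "0 < g" "g < i" "i < m"
    and E: "E (c 0) y" "E y (c (g + 1))" "E (c i) (c 1)" "E (c g) (c (i + 1))"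
  obtains ws where "closed_path E ws" "length ws = m + 1"
proof
  define A B C where "A = map c [1..<g + 1]" and "B = map c [i + 1..<m + 1]"
    and "C = map c [g + 1..<i + 1]"
  have "inj_on c {1..<1 + m}" by (rule cyclic_seq_inj_on_window[OF c])
  then have "inj_on c (set ([1..<g + 1] @ [i + 1..<m + 1] @ [g + 1..<i + 1]))"
    by (rule inj_on_subset) (use assms in auto)
  then have "distinct (map c ([1..<g + 1] @ [i + 1..<m + 1] @ [g + 1..<i + 1]))"
    using assms(3-5) by (subst distinct_map) (auto simp del: upt_Suc)
  then have "distinct (A @ B @ C)" by (simp add: A_def B_def C_def del: upt_Suc)
  moreover have "y \<notin> set (A @ B @ C)" using y by (auto simp: A_def B_def C_def)
  ultimately have d: "distinct (A @ B @ [y] @ C)" by auto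
  have ne: "A \<noteq> []" "B \<noteq> []" "C \<noteq> []" using assms by (simp_all add: A_def B_def C_def)
  have hd: "hd A = c 1" "hd B = c (i + 1)" "hd C = c (g + 1)"
    using assms by (simp_all add: A_def B_def C_def upt_conv_Cons del: upt_Suc)
  have last: "last A = c g" "last B = c 0" "last C = c i"
    using assms cyclic_seqD(2)[OF c, of 0] by (simp_all add: A_def B_def C_def last_map)
  have seg: "successively E A" "successively E B" "successively E C"
    unfolding A_def B_def C_def by (rule cyclic_seq_segment[OF c])+
  have "successively E (A @ B @ [y] @ C @ [hd A])"
    using ne hd last seg E by (simp add: successively_append_iff successively_Cons[of E y])
  then show "closed_path E (A @ B @ [y] @ C)"
    using d ne by (simp add: closed_path_def)
  show "length (A @ B @ [y] @ C) = m + 1" using assms by (simp add: A_def B_def C_def)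
qed

text \<open>
  The bound on \<open>set ws\<close> keeps a path inside a set of vertices when \<open>E\<close> is a relation all of whose
  arcs end in that set.
\<close>

lemma rtranclp_imp_distinct_path:
  assumes "E\<^sup>*\<^sup>* u v"
  obtains ws where "ws \<noteq> []" "hd ws = u" "last ws = v" "distinct ws" "successively E ws"
    "set ws \<subseteq> insert u (Collect (\<lambda>x. \<exists>w. E w x))"
proof -
  have "\<exists>ws. ws \<noteq> [] \<and> hd ws = u \<and> last ws = v \<and> distinct ws \<and> successively E ws \<and>
    set ws \<subseteq> insert u (Collect (\<lambda>x. \<exists>w. E w x))"
    using assms
  proof (induction rule: converse_rtranclp_induct)
    case base
    show ?case by (intro exI[of _ "[v]"]) auto
  next
    case (step a b)
    then obtain ws where ws: "ws \<noteq> []" "hd ws = b" "last ws = v" "distinct ws" "successively E ws"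
      "set ws \<subseteq> insert b (Collect (\<lambda>x. \<exists>w. E w x))" by blast
    show ?case
    proof (cases "a \<in> set ws")
      case True
      then obtain xs zs where xs: "ws = xs @ a # zs" by (meson split_list)
      show ?thesis
        using ws xs step(1) by (intro exI[of _ "a # zs"]) (auto simp: successively_append_iff)
    next
      case False
      then show ?thesis
        using ws step(1) by (intro exI[of _ "a # ws"]) (auto simp: successively_Cons)
    qed
  qed
  then show ?thesis using that by blast
qed

section \<open>A longest cycle with no bypass through a single vertex\<close>

text \<open>
  The premises of \<open>degree_sum\<close> are symmetric in \<open>x\<close> and \<open>y\<close>, so the inequality stands for both
  arguments of the minimum.
\<close>

locale degree_sum_digraph =
  fixes V :: "'a set" and E :: "'a \<Rightarrow> 'a \<Rightarrow> bool"
  assumes finite_V: "finite V"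
    and arc_in_V: "E u v \<Longrightarrow> u \<in> V" "E u v \<Longrightarrow> v \<in> V"
    and no_loop: "\<not> E u u"
    and strong: "u \<in> V \<Longrightarrow> v \<in> V \<Longrightarrow> E\<^sup>*\<^sup>* u v"
    and degree_sum: "x \<noteq> y \<Longrightarrow> \<not> E x y \<Longrightarrow> \<not> E y x \<Longrightarrow>
      (\<exists>z. E x z \<and> E y z) \<or> (\<exists>z. E z x \<and> E z y) \<Longrightarrow> card V \<le> outdeg E x + indeg E y"
begin

lemma cyclic_seq_in_V:
  assumes "cyclic_seq E m c"
  shows "range c \<subseteq> V"
  using cyclic_seqD(3)[OF assms] arc_in_V by blast

lemma cyclic_seq_length_ge_2:
  assumes "cyclic_seq E m c"
  shows "2 \<le> m"
proof (rule ccontr)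
  assume "\<not> 2 \<le> m"
  then have "m = 1" using cyclic_seqD(1)[OF assms] by simp
  then have "c (Suc 0) = c 0" using cyclic_seqD(2)[OF assms, of 0] by simp
  then show False using cyclic_seqD(3)[OF assms, of 0] no_loop by simp
qed

lemma card_off_cycle:
  assumes "cyclic_seq E m c"
  shows "card (V - range c) = card V - m" "m \<le> card V"
  using cyclic_seq_card[OF assms] cyclic_seq_in_V[OF assms] finite_V
  by (auto simp: card_Diff_subset intro: card_mono)

end

text \<open>
  Only the length \<open>m\<close> is fixed, not a cycle, because the argument passes between different cycles
  of that length.
\<close>

locale longest_nonspanning_cycle = degree_sum_digraph +
  fixes m :: nat
  assumes misses_two: "m + 2 \<le> card V"
    and longest: "closed_path E ws \<Longrightarrow> length ws < card V \<Longrightarrow> length ws \<le> m"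
begin

lemma bypass_length:
  assumes c: "cyclic_seq E m c" and "g < m"
    and "distinct ys" "set ys \<inter> range c = {}" "successively E (c i # ys @ [c (i + g + 1)])"
  shows "length ys \<le> g \<or> card V \<le> length ys + m - g"
proof -
  obtain ws where "closed_path E ws" "length ws = length ys + m - g"
    by (rule closed_path_bypass[OF assms])
  then show ?thesis using longest[of ws] \<open>g < m\<close> by linarith
qed

lemma no_insertion:
  assumes c: "cyclic_seq E m c" and "y \<notin> range c" "E (c i) y"
  shows "\<not> E y (c (i + 1))"
  using bypass_length[OF c, of 0 "[y]" i] cyclic_seqD(1)[OF c] assms misses_two by auto

text \<open>
  Suppose \<open>c 1 \<rightarrow> y\<close> fails. Then \<open>y\<close> and \<open>c 1\<close> are non-adjacent and both dominated by \<open>c 0\<close>. On the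
  cycle, as there is no bypass, \<open>y\<close> has at most the out-neighbour \<open>c 0\<close> and \<open>c 1\<close> at most \<open>m - 1\<close> in-neighbours; so
  \<open>d\<^sup>+(y) + d\<^sup>-(c\<^sub>1) \<ge> n\<close> requires some \<open>z\<close> off the cycle with \<open>y \<rightarrow> z \<rightarrow> c 1\<close>. That closes
  to a cycle of length \<open>m + 2\<close>, hence \<open>n = m + 2\<close>. Now all estimates are sharp, which gives the
  arcs at \<open>y\<close>, \<open>z\<close> and \<open>c 1\<close> exactly. If the cycle had a third vertex \<open>c 2\<close>, then \<open>z\<close> and \<open>c 2\<close>,
  both dominated by \<open>c 1\<close>, would violate the degree condition; so \<open>m = 2\<close> and \<open>n = 4\<close>.
\<close>

lemma entry_propagates:
  assumes c: "cyclic_seq E m c"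
    and no_bypass: "\<And>v i j. v \<notin> range c \<Longrightarrow> E (c i) v \<Longrightarrow> E v (c j) \<Longrightarrow> c i = c j"
    and y: "y \<notin> range c" "E (c 0) y" and nE: "\<not> E (c 1) y"
  shows "balanced_complete_bipartite V E"
proof -
  have m: "2 \<le> m" using cyclic_seq_length_ge_2[OF c] .
  have fin: "finite (range c)" "card (range c) = m" using cyclic_seq_card[OF c] by auto
  have rV: "range c \<subseteq> V" by (rule cyclic_seq_in_V[OF c])
  have yV: "y \<in> V" using y arc_in_V by blast
  have c01: "c 0 \<noteq> c 1" using cyclic_seq_window_eq[OF c, of 0 1 0] m by auto
  have E01: "E (c 0) (c 1)" using cyclic_seqD(3)[OF c, of 0] by simp
  have ny1: "\<not> E y (c 1)" using no_insertion[OF c y] by simp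
  have d: "card V \<le> outdeg E y + indeg E (c 1)" "card V \<le> outdeg E (c 1) + indeg E y"
    using y nE ny1 E01 by (intro degree_sum; blast)+
  have out_y_C: "v = c 0" if "E y v" "v \<in> range c" for v
    using that no_bypass[OF y(1) y(2)] by auto
  \<comment> \<open>Without such a \<open>z\<close>, the out-neighbours of \<open>y\<close> and the in-neighbours of \<open>c 1\<close> off the cycle are
     disjoint sets avoiding \<open>y\<close>.\<close>
  have "\<exists>z. z \<notin> range c \<and> E y z \<and> E z (c 1)"
  proof (rule ccontr)
    assume none: "\<not> ?thesis"
    let ?A = "{v. E y v} - range c" and ?B = "{v. E v (c 1)} - range c"
    have finV: "finite {v. E y v}" "finite {v. E v (c 1)}"
      using arc_in_V by (auto intro: finite_subset[OF _ finite_V])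
    have "card (?A \<union> ?B) \<le> card (V - range c - {y})"
      using arc_in_V no_loop ny1 finite_V by (intro card_mono) auto
    also have "\<dots> = card V - m - 1"
      using card_off_cycle(1)[OF c] yV y(1) finite_V by (subst card_Diff_singleton) auto
    finally have "card ?A + card ?B \<le> card V - m - 1"
      using none finV by (subst card_Un_disjoint[symmetric]) auto
    moreover have "outdeg E y \<le> card (insert (c 0) ?A)"
      unfolding outdeg_def using out_y_C finV by (intro card_mono) auto
    moreover have "\<dots> \<le> Suc (card ?A)" by (rule card_insert_le_m1) auto
    moreover have "indeg E (c 1) \<le> card (?B \<union> (range c - {c 1}))"
      unfolding indeg_def using no_loop finV fin by (intro card_mono) auto
    moreover have "\<dots> \<le> card ?B + card (range c - {c 1})" by (rule card_Un_le)
    moreover have "card (range c - {c 1}) = m - 1" using fin by (simp add: card_Diff_singleton)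
    ultimately show False using d(1) m misses_two by linarith
  qed
  then obtain z where z: "z \<notin> range c" "E y z" "E z (c 1)" by blast
  have yz: "y \<noteq> z" using z(2) no_loop by blast
  have n: "card V = m + 2"
    using bypass_length[OF c, of 0 "[y, z]" 0] m misses_two y z yz by auto
  have zV: "z \<in> V" using z arc_in_V by blast
  have V: "V = insert y (insert z (range c))"
    using rV yV zV yz y(1) z(1) fin n finite_V
    by (intro card_subset_eq[symmetric]) auto
  have y_out: "{v. E y v} \<subseteq> {c 0, z}"
    using arc_in_V(2)[of y] out_y_C no_loop by (auto simp: V)
  have c1_in: "{v. E v (c 1)} \<subseteq> insert z (range c - {c 1})"
    using arc_in_V(1)[of _ "c 1"] no_loop ny1 by (auto simp: V)
  have c1_out: "{v. E (c 1) v} \<subseteq> insert z (range c - {c 1})"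
    using arc_in_V(2)[of "c 1"] no_loop nE by (auto simp: V)
  have card1: "card (insert z (range c - {c 1})) = m" using fin z m by (simp add: card_Diff_singleton)
  have "c 0 \<noteq> z" "c 1 \<noteq> y" using z(1) y(1) by auto
  then have card2: "card {c 0, z} = 2" by simp
  have "card {v. E y v} \<le> 2" "card {v. E v (c 1)} \<le> m" "card {v. E (c 1) v} \<le> m"
    using card_mono[OF _ y_out] card_mono[OF _ c1_in] card_mono[OF _ c1_out] card1 card2 fin
    by auto
  then have "card {v. E y v} = 2" "card {v. E v (c 1)} = m"
    using d(1) n unfolding outdeg_def indeg_def by linarith+
  then have y_out': "{v. E y v} = {c 0, z}"
    using y_out card2 by (intro card_subset_eq) auto
  then have yc0: "E y (c 0)" by auto
  have y_in: "{v. E v y} \<subseteq> {c 0, z}"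
    using arc_in_V(1)[of _ y] no_loop no_bypass[OF y(1) _ yc0] by (auto simp: V)
  have "card {v. E v y} \<le> 2"
    using card_mono[OF _ y_in] card2 by auto
  then have "card {v. E v y} = 2" "card {v. E (c 1) v} = m"
    using d(2) n \<open>card {v. E (c 1) v} \<le> m\<close> unfolding outdeg_def indeg_def by linarith+
  then have y_in': "{v. E v y} = {c 0, z}" and c1_out': "{v. E (c 1) v} = insert z (range c - {c 1})"
    using card_subset_eq[OF _ y_in] card_subset_eq[OF _ c1_out] card2 card1 fin by auto
  have zy: "E z y" and c1z: "E (c 1) z" using y_in' c1_out' by auto
  have z_nbr: "\<not> E z v" "\<not> E v z" if "v \<in> range c" "v \<noteq> c 1" for v
    using that no_bypass[OF z(1) c1z] no_bypass[OF z(1) _ z(3)] by auto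
  have "m = 2"
  proof (rule ccontr)
    assume "m \<noteq> 2"
    then have m3: "3 \<le> m" using m by simp
    have c2: "c 2 \<noteq> c 0" "c 2 \<noteq> c 1"
      using cyclic_seq_window_eq[OF c, of 2 0 0] cyclic_seq_window_eq[OF c, of 2 1 0] m3 by auto
    have "E (c 1) (c 2)" using cyclic_seqD(3)[OF c, of 1] by (simp add: numeral_2_eq_2)
    then have "card V \<le> outdeg E z + indeg E (c 2)"
      using z_nbr[of "c 2"] c2 c1z z(1) by (intro degree_sum) auto
    moreover have "outdeg E z \<le> card {y, c 1}"
      unfolding outdeg_def
    proof (intro card_mono subsetI)
      fix v assume "v \<in> {v. E z v}"
      then show "v \<in> {y, c 1}" using arc_in_V(2)[of z v] z_nbr(1)[of v] no_loop by (auto simp: V)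
    qed simp
    moreover have "card {y, c 1} \<le> 2" by (simp add: card_insert_if)
    moreover have "\<not> E y (c 2)" using out_y_C[of "c 2"] c2 by auto
    then have "indeg E (c 2) \<le> card (range c - {c 2})"
      unfolding indeg_def using arc_in_V(1)[of _ "c 2"] z_nbr(1)[of "c 2"] c2 no_loop fin
      by (intro card_mono) (auto simp: V)
    moreover have "card (range c - {c 2}) = m - 1" using fin by (simp add: card_Diff_singleton)
    ultimately show False using n m by linarith
  qed
  then have "range c = {c 0, c 1}"
    using cyclic_seq_range[OF c] by (auto simp: lessThan_Suc numeral_2_eq_2)
  then have V4: "V = {y, z, c 0, c 1}" and C2: "range c = {c 0, c 1}" by (auto simp: V)
  have E10: "E (c 1) (c 0)" using c1_out' c01 by auto
  have "E u v \<longleftrightarrow> u \<in> {c 0, z} \<and> v \<in> {c 1, y} \<or> u \<in> {c 1, y} \<and> v \<in> {c 0, z}" for u v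
  proof
    assume "E u v"
    then have uv: "u \<in> V" "v \<in> V" using arc_in_V by auto
    show "u \<in> {c 0, z} \<and> v \<in> {c 1, y} \<or> u \<in> {c 1, y} \<and> v \<in> {c 0, z}"
      using uv \<open>E u v\<close> no_loop z_nbr[of "c 0"] c01 ny1 nE unfolding V4 by auto
  next
    assume "u \<in> {c 0, z} \<and> v \<in> {c 1, y} \<or> u \<in> {c 1, y} \<and> v \<in> {c 0, z}"
    then show "E u v" using E01 E10 y(2) yc0 z(2,3) zy c1z by auto
  qed
  moreover have "V = {c 0, z} \<union> {c 1, y}" "{c 0, z} \<inter> {c 1, y} = {}" "card {c 0, z} = card {c 1, y}"
    using V4 y(1) z(1) yz c01 \<open>c 0 \<noteq> z\<close> \<open>c 1 \<noteq> y\<close> by auto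
  ultimately show ?thesis unfolding balanced_complete_bipartite_def by blast
qed

lemma exists_arc_leaving:
  assumes "C \<subseteq> V" "C \<noteq> {}" "C \<noteq> V"
  shows "\<exists>u v. u \<in> C \<and> v \<notin> C \<and> E u v"
proof (rule ccontr)
  assume none: "\<not> ?thesis"
  obtain u v where uv: "u \<in> C" "v \<in> V" "v \<notin> C" using assms by blast
  have "E\<^sup>*\<^sup>* u v" using strong uv assms by blast
  then have "v \<in> C" using uv(1) none by induction blast+
  with uv show False by blast
qed

lemma path_back:
  assumes "C \<noteq> {}" "C \<subseteq> V" "y \<in> V" "y \<notin> C"
  obtains ys v where "ys \<noteq> []" "hd ys = y" "distinct ys" "set ys \<subseteq> V - C" "successively E ys"
    "E (last ys) v" "v \<in> C"
proof -
  let ?F = "\<lambda>a b. E a b \<and> b \<notin> C"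
  obtain u where u: "u \<in> C" using assms by blast
  have "E\<^sup>*\<^sup>* y u" using strong assms u by blast
  then have "y \<notin> C \<longrightarrow> (\<exists>w v. ?F\<^sup>*\<^sup>* y w \<and> w \<notin> C \<and> E w v \<and> v \<in> C)"
  proof (induction rule: converse_rtranclp_induct)
    case (step a b)
    then show ?case by (cases "b \<in> C") (blast intro: converse_rtranclp_into_rtranclp)+
  qed (use u in blast)
  then obtain w v where w: "?F\<^sup>*\<^sup>* y w" "E w v" "v \<in> C" using assms by blast
  obtain ys where ys: "ys \<noteq> []" "hd ys = y" "last ys = w" "distinct ys" "successively ?F ys"
    "set ys \<subseteq> insert y {x. \<exists>w. ?F w x}"
    by (rule rtranclp_imp_distinct_path[OF w(1)])
  show ?thesis
  proof (rule that)
    show "set ys \<subseteq> V - C" using ys(6) assms arc_in_V by blast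
    show "successively E ys" using ys(5) by (rule successively_mono) auto
    show "E (last ys) v" using w ys by simp
  qed (use ys w in auto)
qed

text \<open>
  Outside the exceptional case every vertex of the cycle dominates \<open>y\<close>, so a path from \<open>y\<close> back to
  the cycle may be entered from wherever it suits: from the predecessor of its end, gaining \<open>length ys\<close>
  vertices, or, if that would be spanning, from the vertex before, which skips exactly one.
\<close>

lemma balanced_complete_bipartite_if_no_bypass:
  assumes c: "cyclic_seq E m c"
    and no_bypass: "\<And>v i j. v \<notin> range c \<Longrightarrow> E (c i) v \<Longrightarrow> E v (c j) \<Longrightarrow> c i = c j"
  shows "balanced_complete_bipartite V E"
proof (rule ccontr)
  assume nb: "\<not> ?thesis"
  have m: "2 \<le> m" using cyclic_seq_length_ge_2[OF c] .
  have rV: "range c \<subseteq> V" by (rule cyclic_seq_in_V[OF c])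
  have step: "E (c (i + 1)) v" if "v \<notin> range c" "E (c i) v" for i v
    using entry_propagates[OF cyclic_seq_shift[OF c, of i]] that nb no_bypass
    unfolding cyclic_seq_shift_range[OF c] by (auto simp: add.commute)
  have "range c \<noteq> V" using cyclic_seq_card[OF c] misses_two by auto
  then obtain i y where y: "E (c i) y" "y \<notin> range c"
    using exists_arc_leaving[OF rV] by auto
  have "E (c (i + k)) y" for k
    by (induction k) (use y step in \<open>auto simp: add.assoc\<close>)
  then have all: "E (c k) y" for k
    using cyclic_seq_position[OF c, of "c k" i] by (metis le_add_diff_inverse rangeI)
  have "y \<in> V" using y arc_in_V by blast
  then obtain ys v where ys: "ys \<noteq> []" "hd ys = y" "distinct ys" "set ys \<subseteq> V - range c"
    "successively E ys" "E (last ys) v" "v \<in> range c"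
    using path_back[of "range c" y] rV y by blast
  obtain j where j: "v = c j" using ys(7) by auto
  have "length ys = card (set ys)" using ys(3) by (simp add: distinct_card)
  also have "\<dots> \<le> card (V - range c)" using ys(4) finite_V by (intro card_mono) auto
  finally have len: "length ys + m \<le> card V" using card_off_cycle[OF c] by simp
  have walk: "successively E (c k # ys @ [c j])" for k
    using ys all[of k] by (simp add: successively_Cons successively_append_iff j)
  have len0: "length ys \<ge> 1" using ys(1) by (cases ys) auto
  show False
  proof (cases "length ys + m = card V")
    case True
    have "c (j + m - 2 + 1 + 1) = c j" using cyclic_seqD(2)[OF c, of j] m
      by (simp add: Suc_diff_Suc numeral_2_eq_2)
    then show False
      using bypass_length[OF c, of 1 ys "j + m - 2"] walk[of "j + m - 2"] ys(3,4) m True misses_two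
      by (auto simp: disjoint_iff subset_iff)
  next
    case False
    have "c (j + m - 1 + 0 + 1) = c j" using cyclic_seqD(2)[OF c, of j] m by simp
    then show False
      using bypass_length[OF c, of 0 ys "j + m - 1"] walk[of "j + m - 1"] ys(3,4) m len len0 False
      by (auto simp: disjoint_iff subset_iff)
  qed
qed

section \<open>A bypass with a gap of minimal length\<close>

text \<open>
  The second form, with the indicator taken at \<open>i + 1\<close>, lets in-neighbours and
  out-neighbours be summed together over the arcs \<open>c\<^sub>i, c\<^sub>i\<^sub>+\<^sub>1\<close> of the cycle.
\<close>

lemma card_split_along_cycle:
  assumes c: "cyclic_seq E m c" and fin: "finite {v. P v}"
  shows "card {v. P v} = (\<Sum>i<m. of_bool (P (c i))) + card ({v. P v} - range c)"
    and "card {v. P v} = (\<Sum>i<m. of_bool (P (c (i + 1)))) + card ({v. P v} - range c)"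
proof -
  have *: "card {v. P v} = (\<Sum>i<m. of_bool (P (d i))) + card ({v. P v} - range d)"
    if d: "cyclic_seq E m d" for d
  proof -
    have "{v. P v} \<inter> range d = d ` ({..<m} \<inter> {i. P (d i)})"
      unfolding cyclic_seq_range[OF d] by auto
    moreover have "inj_on d ({..<m} \<inter> {i. P (d i)})"
      using d by (auto simp: cyclic_seq_def intro: inj_on_subset)
    ultimately have "card ({v. P v} \<inter> range d) = (\<Sum>i<m. of_bool (P (d i)))"
      by (simp add: card_image)
    then show ?thesis using card_Int_Diff[OF fin, of "range d"] by simp
  qed
  show "card {v. P v} = (\<Sum>i<m. of_bool (P (c i))) + card ({v. P v} - range c)"
    by (rule *[OF c])
  show "card {v. P v} = (\<Sum>i<m. of_bool (P (c (i + 1)))) + card ({v. P v} - range c)"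
    using *[OF cyclic_seq_shift[OF c, of 1]] unfolding cyclic_seq_shift_range[OF c] .
qed

text \<open>
  The sum \<open>d\<^sup>+(y) + d\<^sup>-(y) + d\<^sup>-(c\<^sub>1) + d\<^sup>+(c\<^sub>g)\<close> is at least \<open>2 n\<close>. An index \<open>i\<close> beyond the gap
  contributes at most \<open>2\<close> to it: one for \<open>y\<close>, by \<open>no_insertion\<close>, and one for the pair \<open>c\<^sub>1, c\<^sub>g\<close>, by
  \<open>closed_path_reinsert_gap\<close>. The indices \<open>0, \<dots>, g\<close> together contribute at most \<open>2 g + 2\<close>. So
  the cycle accounts for at most \<open>2 m\<close>. A vertex off the cycle other than \<open>y\<close> contributes at most
  \<open>2\<close>, because \<open>y \<rightarrow> v \<rightarrow> c\<^sub>1\<close> or \<open>c\<^sub>g \<rightarrow> v \<rightarrow> y\<close> yields a cycle of length \<open>m + 2\<close> --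
  unless \<open>n = m + 2\<close>, when there is just one such vertex and it contributes at most \<open>4\<close>. The first
  case totals \<open>2 n - 2\<close>, too little; the second totals \<open>2 n\<close>, so every bound is attained.
\<close>

lemma minimal_bypass_tight:
  assumes c: "cyclic_seq E m c" and y: "y \<notin> range c" "E (c 0) y" "E y (c (g + 1))" "g + 1 < m"
    and minimal: "\<And>i k v. v \<notin> range c \<Longrightarrow> k < g \<Longrightarrow> E (c i) v \<Longrightarrow> \<not> E v (c (i + k + 1))"
  obtains z where "z \<notin> range c" "z \<noteq> y" "V = insert y (insert z (range c))"
    "E y z" "E z y" "E z (c 1)" "E (c g) z" "0 < g"
    "\<And>i. g < i \<Longrightarrow> i < m \<Longrightarrow> E (c i) y \<longleftrightarrow> \<not> E y (c (i + 1))"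
proof -
  have g: "0 < g" using y no_insertion[OF c y(1,2)] by (cases g) auto
  have rV: "range c \<subseteq> V" by (rule cyclic_seq_in_V[OF c])
  have yV: "y \<in> V" using y arc_in_V by blast
  have E01: "E (c 0) (c 1)" and Eg: "E (c g) (c (g + 1))" using cyclic_seqD(3)[OF c] by auto
  have gap_in: "\<not> E (c i) y" if "0 < i" "i \<le> g" for i
    using minimal[OF y(1), of "g - i" i] that y(3) by auto
  have gap_out: "\<not> E y (c i)" if "0 < i" "i \<le> g" for i
    using minimal[OF y(1), of "i - 1" 0] that y(2) by auto
  have ne: "y \<noteq> c i" for i using y(1) by auto
  have "card V \<le> outdeg E y + indeg E (c 1)"
    using ne E01 y gap_in[of 1] gap_out[of 1] g by (intro degree_sum) auto
  moreover have "card V \<le> outdeg E (c g) + indeg E y"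
    using ne[of g] Eg y gap_in[of g] gap_out[of g] g by (intro degree_sum) auto
  ultimately have deg: "2 * card V \<le>
      card {v. E y v} + card {v. E v (c 1)} + card {v. E (c g) v} + card {v. E v y}"
    by (simp add: outdeg_def indeg_def)
  define R where "R = V - range c - {y}"
  have finR: "finite R" using finite_V by (simp add: R_def)
  have cardR: "card R = card V - m - 1"
    using card_off_cycle(1)[OF c] yV y(1) finite_V unfolding R_def
    by (subst card_Diff_singleton) auto
  have fin: "finite {v. E w v}" "finite {v. E v w}" for w
    using arc_in_V by (auto intro: finite_subset[OF _ finite_V])
  define Yo where "Yo = {v. E y v} - range c"
  define Yi where "Yi = {v. E v y} - range c"
  define A where "A = {v. E v (c 1)} - range c"
  define B where "B = {v. E (c g) v} - range c"
  have sub: "Yo \<subseteq> R" "Yi \<subseteq> R" "A \<subseteq> R" "B \<subseteq> R"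
    using arc_in_V no_loop gap_out[of 1] gap_in[of g] g
    by (auto simp: Yo_def Yi_def A_def B_def R_def)
  define a :: "nat \<Rightarrow> nat" where "a i = of_bool (E (c i) y) + of_bool (E y (c (i + 1)))" for i
  define b :: "nat \<Rightarrow> nat" where "b i = of_bool (E (c i) (c 1)) + of_bool (E (c g) (c (i + 1)))" for i
  have total: "2 * card V \<le> (\<Sum>i<m. a i + b i) + (card Yo + card A) + (card B + card Yi)"
    using deg card_split_along_cycle(1)[OF c fin(2), of y] card_split_along_cycle(2)[OF c fin(1), of y]
      card_split_along_cycle(1)[OF c fin(2), of "c 1"] card_split_along_cycle(2)[OF c fin(1), of "c g"]
    by (simp add: a_def b_def sum.distrib Yo_def Yi_def A_def B_def)
  have count: "(\<Sum>i<g + 1. of_bool (P i)) \<le> card S"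
    if "finite S" "\<And>i. i \<le> g \<Longrightarrow> P i \<Longrightarrow> i \<in> S" for P and S :: "nat set"
  proof -
    have "(\<Sum>i<g + 1. of_bool (P i)) = card ({..<g + 1} \<inter> {i. P i})"
      by (subst sum_of_bool_eq) auto
    also have "\<dots> \<le> card S" using that by (intro card_mono) auto
    finally show ?thesis .
  qed
  \<comment> \<open>Among the indices up to \<open>g\<close>, each of the four kinds of arcs can occur only at the
     indices of the set on the right: \<open>y\<close> misses the gap, and \<open>c 1\<close> and \<open>c g\<close> have no loops.\<close>
  have "(\<Sum>i<g + 1. of_bool (E (c i) y)) \<le> card {0::nat}"
    using gap_in by (intro count) auto
  moreover have "(\<Sum>i<g + 1. of_bool (E y (c (i + 1)))) \<le> card {g}"
  proof (rule count)
    fix i assume "i \<le> g" "E y (c (i + 1))"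
    then show "i \<in> {g}" using gap_out[of "i + 1"] by (cases "i = g") auto
  qed simp
  moreover have "(\<Sum>i<g + 1. of_bool (E (c i) (c 1))) \<le> card ({..g} - {1})"
    using no_loop by (intro count) auto
  moreover have "(\<Sum>i<g + 1. of_bool (E (c g) (c (i + 1)))) \<le> card ({..g} - {g - 1})"
    using no_loop g by (intro count) auto
  moreover have "card ({..g} - {1}) = g" "card ({..g} - {g - 1}) = g"
    using g by (simp_all add: card_Diff_singleton)
  ultimately have low: "(\<Sum>i<g + 1. a i + b i) \<le> 2 + 2 * g"
    unfolding a_def b_def sum.distrib by simp
  \<comment> \<open>Indices beyond the gap.\<close>
  have a1: "a i \<le> 1" for i
    using no_insertion[OF c y(1), of i] by (auto simp: a_def)
  have b1: "b i \<le> 1" if i: "g < i" "i < m" for i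
  proof (rule ccontr)
    assume "\<not> b i \<le> 1"
    then have "E (c i) (c 1) \<and> E (c g) (c (i + 1))" by (auto simp: b_def of_bool_def split: if_splits)
    then obtain ws where "closed_path E ws" "length ws = m + 1"
      using closed_path_reinsert_gap[OF c y(1) g i y(2,3)] by blast
    then show False using longest[of ws] misses_two by auto
  qed
  have split: "(\<Sum>i<m. a i + b i) = (\<Sum>i<g + 1. a i + b i) + (\<Sum>i=g + 1..<m. a i + b i)"
    using y(4) sum.atLeastLessThan_concat[of 0 "g + 1" m "\<lambda>i. a i + b i"]
    by (simp add: lessThan_atLeast0)
  have high: "(\<Sum>i=g + 1..<m. a i + b i) \<le> (\<Sum>i=g + 1..<m. 2)"
  proof (rule sum_mono)
    show "a j + b j \<le> 2" if "j \<in> {g + 1..<m}" for j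
      using a1[of j] b1[of j] that by auto
  qed
  have n: "card V = m + 2"
  proof (rule ccontr)
    assume "card V \<noteq> m + 2"
    then have n3: "m + 3 \<le> card V" using misses_two by simp
    have "Yo \<inter> A = {}"
    proof (rule ccontr)
      assume "Yo \<inter> A \<noteq> {}"
      then obtain w where "E y w" "E w (c 1)" "w \<notin> range c" by (auto simp: Yo_def A_def)
      then show False
        using bypass_length[OF c, of 0 "[y, w]" 0] y n3 no_loop by auto
    qed
    then have "card Yo + card A \<le> card R"
      using sub finR by (subst card_Un_disjoint[symmetric]) (auto intro: finite_subset card_mono)
    moreover have "B \<inter> Yi = {}"
    proof (rule ccontr)
      assume "B \<inter> Yi \<noteq> {}"
      then obtain w where "E w y" "E (c g) w" "w \<notin> range c" by (auto simp: Yi_def B_def)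
      then show False
        using bypass_length[OF c, of 0 "[w, y]" g] y n3 no_loop by auto
    qed
    then have "card B + card Yi \<le> card R"
      using sub finR by (subst card_Un_disjoint[symmetric]) (auto intro: finite_subset card_mono)
    ultimately show False using total split low high cardR n3 y(4) by simp
  qed
  then have "card R = 1" using cardR by simp
  then obtain z where Rz: "R = {z}" by (auto simp: card_1_singleton_iff)
  have le1: "card Yo \<le> 1" "card Yi \<le> 1" "card A \<le> 1" "card B \<le> 1"
    using sub[THEN card_mono[OF finR]] \<open>card R = 1\<close> by auto
  have "(\<Sum>i=g + 1..<m. (2::nat)) = 2 * (m - (g + 1))" by simp
  then have sharp: "card Yo = 1" "card Yi = 1" "card A = 1" "card B = 1"
    "(\<Sum>i=g + 1..<m. a i + b i) = (\<Sum>i=g + 1..<m. 2)"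
    using total split low high le1 n y(4) by linarith+
  have eq: "Yo = {z}" "Yi = {z}" "A = {z}" "B = {z}"
    using sub sharp(1-4) by (auto simp: Rz subset_singleton_iff)
  have ab: "a i + b i = 2" if "g < i" "i < m" for i
  proof (rule sum_mono_inv[OF sharp(5)])
    show "a j + b j \<le> 2" if "j \<in> {g + 1..<m}" for j
      using a1[of j] b1[of j] that by auto
  qed (use that in auto)
  show ?thesis
  proof (rule that)
    show "z \<notin> range c" "z \<noteq> y" using Rz by (auto simp: R_def)
    show "V = insert y (insert z (range c))" using Rz rV yV by (auto simp: R_def)
    show "E y z" "E z y" "E z (c 1)" "E (c g) z" using eq by (auto simp: Yo_def Yi_def A_def B_def)
    show "E (c i) y \<longleftrightarrow> \<not> E y (c (i + 1))" if "g < i" "i < m" for i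
      using ab[OF that] a1[of i] b1[OF that] by (auto simp: a_def of_bool_def split: if_splits)
  qed (rule g)
qed

text \<open>
  Both \<open>c (m - 1), y, z, c 1\<close> and \<open>c g, z, y, c (g + 2)\<close> would skip one vertex of the cycle and
  take in two, which gives length \<open>n - 1\<close>. Hence neither \<open>c (m - 1) \<rightarrow> y\<close> nor
  \<open>y \<rightarrow> c (g + 2)\<close> holds, and as exactly one of \<open>c i \<rightarrow> y\<close> and \<open>y \<rightarrow> c (i + 1)\<close> does for every \<open>i\<close>
  beyond the gap, \<open>y \<rightarrow> c 0\<close> and \<open>c (g + 1) \<rightarrow> y\<close> follow. If \<open>g > 1\<close>, then \<open>c k \<rightarrow> y\<close> is
  inherited by \<open>c (k + 1)\<close> all the way from \<open>k = g + 1\<close> to \<open>k = m - 1\<close>: otherwise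
  \<open>y \<rightarrow> c (k + 2)\<close>, which makes a bypass with a gap of one vertex.
\<close>

lemma minimal_bypass_gap_one:
  assumes c: "cyclic_seq E m c" and y: "y \<notin> range c" "E (c 0) y" "E y (c (g + 1))" "g + 1 < m"
    and minimal: "\<And>i k v. v \<notin> range c \<Longrightarrow> k < g \<Longrightarrow> E (c i) v \<Longrightarrow> \<not> E v (c (i + k + 1))"
  shows "g = 1" "E y (c 0)" "E (c (g + 1)) y" "\<not> E (c (m - 1)) y"
proof -
  obtain z where z: "z \<notin> range c" "z \<noteq> y" "V = insert y (insert z (range c))"
    "E y z" "E z y" "E z (c 1)" "E (c g) z" "0 < g"
    and xor: "\<And>i. g < i \<Longrightarrow> i < m \<Longrightarrow> E (c i) y \<longleftrightarrow> \<not> E y (c (i + 1))"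
    by (rule minimal_bypass_tight[OF assms]) auto
  have n: "card V = m + 2" using z(1,2,3) y(1) cyclic_seq_card[OF c] by auto
  have "c (m - 1 + 1 + 1) = c 1" using cyclic_seqD(2)[OF c, of 1] y(4) by simp
  then show n1: "\<not> E (c (m - 1)) y"
    using bypass_length[OF c, of 1 "[y, z]" "m - 1"] y z n by auto
  have n2: "\<not> E y (c (g + 2))"
    using bypass_length[OF c, of 1 "[z, y]" g] y z n by auto
  have "c (m - 1 + 1) = c 0" using cyclic_seqD(2)[OF c, of 0] y(4) by simp
  then show "E y (c 0)" using xor[of "m - 1"] n1 y(4) by auto
  show Eg: "E (c (g + 1)) y" using xor[of "g + 1"] n2 y(4) by simp
  show "g = 1"
  proof (rule ccontr)
    assume "g \<noteq> 1"
    then have "1 < g" using z(8) by simp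
    have "g + 1 + k < m \<Longrightarrow> E (c (g + 1 + k)) y" for k
    proof (induction k)
      case (Suc k)
      then have "E (c (g + 1 + k)) y" by simp
      then have "\<not> E y (c (g + 1 + k + 1 + 1))" by (rule minimal[OF y(1) \<open>1 < g\<close>])
      then show ?case using xor[of "g + 1 + Suc k"] Suc.prems by simp
    qed (use Eg in simp)
    moreover have "g + 1 + (m - 1 - (g + 1)) = m - 1" using y(4) by simp
    ultimately show False using n1 y(4) by (metis diff_less less_numeral_extra(1) less_trans zero_less_Suc Suc_eq_plus1)
  qed
qed

end

section \<open>Alternation along the cycle\<close>

locale two_off_cycle = longest_nonspanning_cycle +
  fixes c :: "nat \<Rightarrow> 'a" and y z :: 'a
  assumes cycle_c: "cyclic_seq E m c"
    and off: "y \<notin> range c" "z \<notin> range c" "y \<noteq> z"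
    and V_eq: "V = insert y (insert z (range c))"
begin

text \<open>
  A bypass with a gap of one vertex is minimal wherever on the cycle it occurs, since a gap of length
  \<open>0\<close> would be an insertion. So the two preceding lemmas apply at every such bypass; their
  conclusions are collected here, and the dichotomy between \<open>c j \<rightarrow> y\<close> and \<open>y \<rightarrow> c (j + 1)\<close>, which
  is also clear at the two indices at the gap, extends to all of the cycle.
\<close>

lemma bypass_facts:
  assumes "E (c i) y" "E y (c (i + 2))" "3 \<le> m"
  shows "\<not> E (c (i + 1)) y" "\<not> E y (c (i + 1))" "E y z" "E z y" "E z (c (i + 1))" "E (c (i + 1)) z"
    "E y (c i)" "E (c (i + 2)) y" "\<not> E (c (i + m - 1)) y"
    "E (c j) y \<longleftrightarrow> \<not> E y (c (j + 1))"
proof -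
  let ?d = "\<lambda>k. c (k + i)"
  have d: "cyclic_seq E m ?d" "range ?d = range c"
    using cyclic_seq_shift[OF cycle_c] cyclic_seq_shift_range[OF cycle_c] by auto
  have min: "\<And>h k v. v \<notin> range ?d \<Longrightarrow> k < 1 \<Longrightarrow> E (?d h) v \<Longrightarrow> \<not> E v (?d (h + k + 1))"
    using no_insertion[OF d(1)] by auto
  have prem: "y \<notin> range ?d" "E (?d 0) y" "E y (?d (1 + 1))" "1 + 1 < m"
    using off assms d by (auto simp: add.commute numeral_2_eq_2)
  obtain z' where z': "z' \<notin> range ?d" "z' \<noteq> y" "V = insert y (insert z' (range ?d))"
    "E y z'" "E z' y" "E z' (?d 1)" "E (?d 1) z'" "(0::nat) < 1"
    "\<And>i. 1 < i \<Longrightarrow> i < m \<Longrightarrow> E (?d i) y \<longleftrightarrow> \<not> E y (?d (i + 1))"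
    by (rule minimal_bypass_tight[OF d(1) prem min]) auto
  have "z' = z" using z'(1,2,3) V_eq off d(2) by auto
  then show "E y z" "E z y" "E z (c (i + 1))" "E (c (i + 1)) z" using z' by (auto simp: add.commute)
  show "E y (c i)" "E (c (i + 2)) y" "\<not> E (c (i + m - 1)) y"
    using minimal_bypass_gap_one(2-4)[OF d(1) prem min] assms(3)
    by (auto simp: add.commute eval_nat_numeral)
  show ni: "\<not> E y (c (i + 1))" using no_insertion[OF cycle_c off(1) assms(1)] .
  show no: "\<not> E (c (i + 1)) y"
    using no_insertion[OF cycle_c off(1), of "i + 1"] assms(2) by (auto simp: eval_nat_numeral)
  have window: "E (c (k + i)) y \<longleftrightarrow> \<not> E y (c (k + i + 1))" if "k < m" for k
  proof -
    consider "k = 0" | "k = 1" | "1 < k" by linarith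
    then show ?thesis
      using assms(1,2) ni no z'(9)[OF _ that] by cases (auto simp: add.commute eval_nat_numeral)
  qed
  obtain j' where j': "i \<le> j'" "j' < i + m" "c j = c j'"
    by (rule cyclic_seq_position[OF cycle_c rangeI])
  then have "(j + 1) mod m = (j' + 1) mod m"
    by (simp add: cyclic_seq_eq_iff[OF cycle_c]) (metis mod_Suc_eq)
  then have "c (j + 1) = c (j' + 1)" by (simp add: cyclic_seq_eq_iff[OF cycle_c])
  then show "E (c j) y \<longleftrightarrow> \<not> E y (c (j + 1))"
    using window[of "j' - i"] j' by auto
qed

text \<open>
  If \<open>c (i + 3)\<close> also dominated \<open>y\<close>, then so would every later vertex of the cycle: two
  consecutive vertices \<open>c j, c (j + 1)\<close> that dominate \<open>y\<close>, followed by one that does not, make a bypass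
  at \<open>j + 1\<close> whose predecessor \<open>c j\<close> dominates \<open>y\<close>, contrary to \<open>bypass_facts\<close>. But
  \<open>c (i + 1)\<close> is met again and does not dominate \<open>y\<close>.
\<close>

lemma bypass_advances:
  assumes "E (c i) y" "E y (c (i + 2))" "3 \<le> m"
  shows "E (c (i + 2)) y" "E y (c (i + 2 + 2))"
proof -
  show b: "E (c (i + 2)) y" using bypass_facts(8)[OF assms] .
  have "\<not> E (c (i + 3)) y"
  proof
    assume b': "E (c (i + 3)) y"
    have "E (c (i + 2 + k)) y \<and> E (c (i + 3 + k)) y" for k
    proof (induction k)
      case (Suc k)
      have "E (c (i + 4 + k)) y"
      proof (rule ccontr)
        assume "\<not> E (c (i + 4 + k)) y"
        then have "E y (c (i + 3 + k + 2))"
          using bypass_facts(10)[OF assms, of "i + 4 + k"] by (simp add: eval_nat_numeral)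
        then have "\<not> E (c (i + 3 + k + m - 1)) y"
          using bypass_facts(9)[OF _ _ assms(3)] Suc by blast
        moreover have "c (i + 3 + k + m - 1) = c (i + 2 + k)"
          using cyclic_seqD(2)[OF cycle_c, of "i + 2 + k"] by (simp add: eval_nat_numeral)
        ultimately show False using Suc by simp
      qed
      then show ?case using Suc by (simp add: eval_nat_numeral)
    qed (use b b' in simp)
    from this[of "m - 1"] have "E (c (i + 2 + (m - 1))) y" by simp
    moreover have "c (i + 2 + (m - 1)) = c (i + 1)"
      using cyclic_seqD(2)[OF cycle_c, of "i + 1"] assms(3) by simp
    ultimately show False using bypass_facts(1)[OF assms] by simp
  qed
  then show "E y (c (i + 2 + 2))"
    using bypass_facts(10)[OF assms, of "i + 3"] by (simp add: eval_nat_numeral)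
qed

lemma alternating:
  assumes "E (c 0) y" "E y (c 2)" "3 \<le> m"
  shows "even m" "E y z" "E z y"
    "E y (c (2 * k))" "E (c (2 * k)) y" "\<not> E y (c (2 * k + 1))" "\<not> E (c (2 * k + 1)) y"
    "E z (c (2 * k + 1))" "E (c (2 * k + 1)) z" "\<not> E z (c (2 * k))" "\<not> E (c (2 * k)) z"
proof -
  have step: "E (c (2 * k)) y \<and> E y (c (2 * k + 2))" for k
  proof (induction k)
    case (Suc k)
    then show ?case using bypass_advances[of "2 * k"] assms(3) by simp
  qed (use assms in \<open>simp add: numeral_2_eq_2\<close>)
  note F = bypass_facts[OF conjunct1[OF step] conjunct2[OF step] assms(3)]
  show ev: "even m"
  proof (rule ccontr)
    assume "odd m"
    then obtain h where "m = 2 * h + 1" by (blast elim: oddE)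
    then have "c (2 * (h + 1)) = c 1" using cyclic_seqD(2)[OF cycle_c, of 1] by simp
    then show False using F(1)[of 0] step[of "h + 1"] by simp
  qed
  show "E y z" "E z y" using F(3,4) by auto
  show "E y (c (2 * k))" "E (c (2 * k)) y" "\<not> E y (c (2 * k + 1))" "\<not> E (c (2 * k + 1)) y"
    "E z (c (2 * k + 1))" and cz: "E (c (2 * k + 1)) z" for k
    using F(1,2,5-8) step by auto
  show "\<not> E (c (2 * k)) z"
    using no_insertion[OF cycle_c off(2), of "2 * k"] F(5)[of k] by auto
  obtain h where h: "m = 2 * h" using ev by (blast elim: evenE)
  then have "2 * (k + h - 1) + 1 + 1 = 2 * k + m" using assms(3) by simp
  then have "c (2 * (k + h - 1) + 1 + 1) = c (2 * k)" using cyclic_seqD(2)[OF cycle_c] by simp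
  then show "\<not> E z (c (2 * k))"
    using no_insertion[OF cycle_c off(2) cz[of "k + h - 1"]] by simp
qed

lemma two_off_cycle_shift: "two_off_cycle V E m (\<lambda>i. c (i + k)) y z"
  using cyclic_seq_shift[OF cycle_c] off V_eq
  by unfold_locales (simp_all add: cyclic_seq_shift_range[OF cycle_c])

lemma two_off_cycle_swap_off: "two_off_cycle V E m c z y"
  using cycle_c off V_eq by unfold_locales auto

text \<open>
  The situation is reproduced by another cycle of length \<open>m\<close>, in which \<open>y\<close> takes the place of
  \<open>c 1\<close>. Whatever is proved about the vertex \<open>y\<close> off the cycle thereby holds for \<open>c 1\<close>.
\<close>

lemma two_off_cycle_exchange:
  assumes "E (c 0) y" "E y (c 2)" "3 \<le> m"
  shows "two_off_cycle V E m (\<lambda>i. if i mod m = 1 then y else c i) (c 1) z"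
proof -
  let ?d = "\<lambda>i. if i mod m = 1 then y else c i"
  have c1: "c i = c 1 \<longleftrightarrow> i mod m = 1" for i
    using cyclic_seq_eq_iff[OF cycle_c, of i 1] assms(3) by simp
  have arcs: "E (?d i) (?d (Suc i))" for i
  proof -
    consider "i mod m = 1" | "Suc i mod m = 1" | "i mod m \<noteq> 1" "Suc i mod m \<noteq> 1" by blast
    then show ?thesis
    proof cases
      case 1
      then have "Suc i mod m = 2" using assms(3) by (simp add: mod_Suc)
      then have "c (Suc i) = c 2" using assms(3) by (simp add: cyclic_seq_eq_iff[OF cycle_c])
      then show ?thesis using 1 \<open>Suc i mod m = 2\<close> assms(2) by simp
    next
      case 2
      then have "i mod m = 0" using assms(3) by (auto simp: mod_Suc split: if_splits)
      then have "c i = c 0" by (simp add: cyclic_seq_eq_iff[OF cycle_c])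
      then show ?thesis using 2 \<open>i mod m = 0\<close> assms(1) by simp
    next
      case 3
      then show ?thesis using cyclic_seqD(3)[OF cycle_c] by simp
    qed
  qed
  have "inj_on ?d {..<m}"
  proof (rule inj_onI)
    fix i j assume *: "i \<in> {..<m}" "j \<in> {..<m}" "?d i = ?d j"
    then have "c i = c j" using off(1) c1[of i] c1[of j] by (auto split: if_splits)
    then show "i = j" using * by (simp add: cyclic_seq_eq_iff[OF cycle_c])
  qed
  then have d: "cyclic_seq E m ?d"
    unfolding cyclic_seq_def using arcs cyclic_seqD[OF cycle_c] by auto
  have rd: "range ?d = insert y (range c - {c 1})"
  proof (intro equalityI subsetI)
    fix v assume "v \<in> insert y (range c - {c 1})"
    then consider "v = y" | i where "v = c i" "c i \<noteq> c 1" by auto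
    then show "v \<in> range ?d"
    proof cases
      case 1
      then have "v = ?d 1" using assms(3) by simp
      then show ?thesis by blast
    next
      case 2
      then have "v = ?d i" using c1 by simp
      then show ?thesis by blast
    qed
  qed (use c1 in auto)
  have c1_on: "c 1 \<in> range c" by blast
  show ?thesis
  proof (intro two_off_cycle.intro two_off_cycle_axioms.intro)
    show "cyclic_seq E m ?d" by (rule d)
    show "c 1 \<notin> range ?d" "z \<notin> range ?d" "c 1 \<noteq> z" "V = insert (c 1) (insert z (range ?d))"
      unfolding rd using off V_eq c1_on by auto
  qed (rule longest_nonspanning_cycle_axioms)
qed

text \<open>
  Shift \<open>c (2 * a + 1)\<close> to index \<open>1\<close>, exchange it with \<open>y\<close>, and apply \<open>alternating\<close> to the new
  cycle.
\<close>

lemma odd_positions: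
  assumes "E (c 0) y" "E y (c 2)" "3 \<le> m"
  shows "E (c (2 * a + 1)) (c (2 * b))" "E (c (2 * b)) (c (2 * a + 1))"
    "\<not> E (c (2 * a + 1)) (c (2 * b + 1))"
proof -
  let ?e = "\<lambda>i. c (i + 2 * a)"
  let ?d = "\<lambda>i. if i mod m = 1 then y else ?e i"
  interpret e: two_off_cycle V E m ?e y z by (rule two_off_cycle_shift)
  have ey: "E (?e 0) y" "E y (?e 2)"
    using alternating(5)[OF assms, of a] alternating(4)[OF assms, of "a + 1"] by simp_all
  interpret d: two_off_cycle V E m ?d "?e 1" z
    by (rule e.two_off_cycle_exchange[OF ey assms(3)])
  have "E (?e 0) (?e 1)" "E (?e 1) (?e 2)"
    using cyclic_seqD(3)[OF cycle_c, of "2 * a"] cyclic_seqD(3)[OF cycle_c, of "2 * a + 1"] by simp_all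
  then have de: "E (?d 0) (?e 1)" "E (?e 1) (?d 2)" using assms(3) by auto
  note D = d.alternating[OF de assms(3)]
  have ev: "even m" by (rule D(1))
  \<comment> \<open>A natural number with \<open>k + a\<close> congruent to \<open>b\<close> modulo \<open>m\<close>.\<close>
  define k where "k = b + a * (m - 1)"
  have "2 * k + 2 * a = 2 * b + 2 * a * m"
    using assms(3) by (cases m) (simp_all add: k_def algebra_simps)
  then have "2 * k + 2 * a = 2 * b + (2 * a) * m" "2 * k + 1 + 2 * a = 2 * b + 1 + (2 * a) * m"
    by simp_all
  then have "(2 * k + 2 * a) mod m = (2 * b) mod m" "(2 * k + 1 + 2 * a) mod m = (2 * b + 1) mod m"
    by (simp_all only: mod_mult_self1)
  then have ck: "?e (2 * k) = c (2 * b)" "?e (2 * k + 1) = c (2 * b + 1)"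
    by (simp_all add: cyclic_seq_eq_iff[OF cycle_c])
  have "even (2 * k mod m)" using ev by (simp add: dvd_mod)
  then have "2 * k mod m \<noteq> 1" by (metis odd_one)
  then show "E (c (2 * a + 1)) (c (2 * b))" "E (c (2 * b)) (c (2 * a + 1))"
    using D(4,5)[of k] ck by (simp_all add: add.commute)
  show "\<not> E (c (2 * a + 1)) (c (2 * b + 1))"
  proof (cases "c (2 * a + 1) = c (2 * b + 1)")
    case False
    then have "(2 * k + 1) mod m \<noteq> 1"
      using ck(2) cyclic_seq_eq_iff[OF e.cycle_c, of "2 * k + 1" 1] assms(3) by (auto simp: add.commute)
    then show ?thesis using D(6)[of k] ck by (simp add: add.commute)
  qed (simp add: no_loop)
qed

text \<open>
  Shifting the cycle by one index exchanges the roles of \<open>y\<close> and \<open>z\<close> and of the odd and the even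
  indices, so that \<open>odd_positions\<close> also shows that the vertices of even index are independent.
\<close>

lemma balanced_complete_bipartite_if_bypass:
  assumes "E (c 0) y" "E y (c 2)" "3 \<le> m"
  shows "balanced_complete_bipartite V E"
proof -
  note A = alternating[OF assms]
  obtain h where h: "m = 2 * h" using A(1) by (blast elim: evenE)
  interpret s: two_off_cycle V E m "\<lambda>i. c (i + 1)" z y
    by (rule two_off_cycle.two_off_cycle_swap_off[OF two_off_cycle_shift])
  have sz: "E (c (0 + 1)) z" "E z (c (2 + 1))"
    using A(9)[of 0] A(8)[of 1] by simp_all
  have even_indep: "\<not> E (c (2 * a)) (c (2 * b))" for a b
  proof -
    have *: "c (2 * (a + m - 1) + 1 + 1) = c (2 * a)" for a
    proof -
      have "2 * (a + m - 1) + 1 + 1 = 2 * a + 2 * m" using assms(3) by simp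
      then show ?thesis by (simp add: cyclic_seq_eq_iff[OF cycle_c])
    qed
    show ?thesis using s.odd_positions(3)[OF sz assms(3), of "a + m - 1" "b + m - 1"] unfolding * .
  qed
  define X where "X = insert z ((\<lambda>k. c (2 * k)) ` {..<h})"
  define Y where "Y = insert y ((\<lambda>k. c (2 * k + 1)) ` {..<h})"
  have rc: "range c = (\<lambda>k. c (2 * k)) ` {..<h} \<union> (\<lambda>k. c (2 * k + 1)) ` {..<h}"
  proof (intro equalityI subsetI)
    fix v assume "v \<in> range c"
    then obtain i where i: "i < m" "v = c i" unfolding cyclic_seq_range[OF cycle_c] by auto
    show "v \<in> (\<lambda>k. c (2 * k)) ` {..<h} \<union> (\<lambda>k. c (2 * k + 1)) ` {..<h}"
    proof (cases "even i")
      case True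
      then show ?thesis using i h by (auto elim!: evenE)
    next
      case False
      then show ?thesis using i h by (auto elim!: oddE)
    qed
  qed auto
  have inj: "i = j" if "c i = c j" "i < m" "j < m" for i j
    using cyclic_seq_window_eq[OF cycle_c that(1), of 0] that by simp
  have "c (2 * k) \<noteq> c (2 * l + 1)" if "k < h" "l < h" for k l
  proof
    assume "c (2 * k) = c (2 * l + 1)"
    then have "2 * k = 2 * l + 1" by (rule inj) (use that h in auto)
    then show False by presburger
  qed
  then have disj: "X \<inter> Y = {}"
    using off by (auto simp: X_def Y_def)
  have V: "V = X \<union> Y" unfolding V_eq rc by (auto simp: X_def Y_def)
  have "inj_on (\<lambda>k. c (2 * k)) {..<h}" "inj_on (\<lambda>k. c (2 * k + 1)) {..<h}"
    using inj h by (fastforce intro!: inj_onI)+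
  then have "card ((\<lambda>k. c (2 * k)) ` {..<h}) = h" "card ((\<lambda>k. c (2 * k + 1)) ` {..<h}) = h"
    by (simp_all only: card_image card_lessThan)
  moreover have "z \<notin> (\<lambda>k. c (2 * k)) ` {..<h}" "y \<notin> (\<lambda>k. c (2 * k + 1)) ` {..<h}"
    using off by auto
  ultimately have "card X = card Y" by (simp add: X_def Y_def)
  moreover have "E u v \<longleftrightarrow> u \<in> X \<and> v \<in> Y \<or> u \<in> Y \<and> v \<in> X" for u v
  proof
    assume "u \<in> X \<and> v \<in> Y \<or> u \<in> Y \<and> v \<in> X"
    then show "E u v" using A odd_positions[OF assms] by (auto simp: X_def Y_def)
  next
    assume "E u v"
    moreover have "\<not> E u v" if "u \<in> X \<and> v \<in> X \<or> u \<in> Y \<and> v \<in> Y"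
      using that A odd_positions[OF assms] even_indep no_loop by (auto simp: X_def Y_def)
    ultimately show "u \<in> X \<and> v \<in> Y \<or> u \<in> Y \<and> v \<in> X"
      using arc_in_V[of u v] V by blast
  qed
  ultimately show ?thesis
    unfolding balanced_complete_bipartite_def using V disj
    by (intro exI[of _ X] exI[of _ Y]) simp
qed

end

lemma (in longest_nonspanning_cycle) balanced_complete_bipartite_if_cycle:
  assumes c: "cyclic_seq E m c"
  shows "balanced_complete_bipartite V E"
proof (cases "\<forall>v i j. v \<notin> range c \<longrightarrow> E (c i) v \<longrightarrow> E v (c j) \<longrightarrow> c i = c j")
  case True
  then show ?thesis by (intro balanced_complete_bipartite_if_no_bypass[OF c]) blast
next
  case False
  then obtain v i j where v: "v \<notin> range c" "E (c i) v" "E v (c j)" "c i \<noteq> c j" by blast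
  \<comment> \<open>The lengths of the gaps; the end \<open>c j\<close> is renumbered to lie within one turn after \<open>c i\<close>.\<close>
  let ?P = "\<lambda>g. \<exists>i v. v \<notin> range c \<and> E (c i) v \<and> E v (c (i + g + 1))"
  obtain j' where j': "i + 1 \<le> j'" "j' < i + 1 + m" "c j = c j'"
    by (rule cyclic_seq_position[OF c rangeI])
  have "j' \<noteq> i + m" using v(4) j'(3) cyclic_seqD(2)[OF c, of i] by auto
  have P: "?P (j' - i - 1)" using v j' by (intro exI[of _ i] exI[of _ v]) simp
  define g where "g = (LEAST g. ?P g)"
  have "g \<le> j' - i - 1" unfolding g_def by (rule Least_le[of ?P, OF P])
  then have gm: "g + 1 < m" using j' \<open>j' \<noteq> i + m\<close> by linarith
  have "?P g" unfolding g_def by (rule LeastI[of ?P, OF P])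
  then obtain i y where y: "y \<notin> range c" "E (c i) y" "E y (c (i + g + 1))" by blast
  have least: "\<not> ?P k" if "k < g" for k using that unfolding g_def by (rule not_less_Least)
  let ?d = "\<lambda>k. c (k + i)"
  have d: "cyclic_seq E m ?d" "range ?d = range c"
    using cyclic_seq_shift[OF c] cyclic_seq_shift_range[OF c] by auto
  have min: "\<not> E v (?d (h + k + 1))" if "v \<notin> range ?d" "k < g" "E (?d h) v" for h k v
  proof
    assume "E v (?d (h + k + 1))"
    then have "E v (c (h + i + k + 1))" by (simp add: ac_simps)
    then show False using least[OF that(2)] that(1,3) unfolding d(2) by blast
  qed
  have prem: "y \<notin> range ?d" "E (?d 0) y" "E y (?d (g + 1))"
    using y d by (auto simp: ac_simps)
  have g: "g = 1" by (rule minimal_bypass_gap_one(1)[OF d(1) prem gm min])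
  obtain z where z: "z \<notin> range ?d" "z \<noteq> y" "V = insert y (insert z (range ?d))"
    by (rule minimal_bypass_tight[OF d(1) prem gm min]) auto
  interpret two_off_cycle V E m ?d y z
    using d prem z by unfold_locales auto
  show ?thesis
    using prem gm g by (intro balanced_complete_bipartite_if_bypass) (auto simp: numeral_2_eq_2)
qed

section \<open>Choice of a longest non-spanning cycle\<close>

context degree_sum_digraph
begin

lemma closed_path_length_le:
  assumes "closed_path E ws"
  shows "length ws \<le> card V"
  using assms by (rule closed_path_imp_cyclic_seq) (rule card_off_cycle(2))

lemma exists_closed_path:
  assumes "2 \<le> card V"
  shows "\<exists>ws. closed_path E ws"
proof -
  obtain u v where "u \<in> V" "v \<in> V" "u \<noteq> v"
    using assms finite_V by (metis card_le_Suc0_iff_eq not_less_eq_eq numeral_2_eq_2)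
  then have "E\<^sup>*\<^sup>* u v" by (intro strong)
  then obtain w where w: "E u w"
    using \<open>u \<noteq> v\<close> by (cases rule: converse_rtranclpE) auto
  have "E\<^sup>*\<^sup>* w u" by (intro strong arc_in_V(2)[OF w] \<open>u \<in> V\<close>)
  then obtain ws where "ws \<noteq> []" "hd ws = w" "last ws = u" "distinct ws" "successively E ws"
    by (rule rtranclp_imp_distinct_path)
  then have "closed_path E ws"
    using w by (auto simp: closed_path_def successively_append_iff)
  then show ?thesis ..
qed

lemma shorter_closed_path:
  assumes ws: "closed_path E ws" "length ws = card V" and uv: "E u v" "E u w" "v \<noteq> w"
  obtains ws' where "closed_path E ws'" "length ws' < card V"
proof -
  obtain c where c: "cyclic_seq E (card V) c"
    using closed_path_imp_cyclic_seq[OF ws(1)] ws(2) by metis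
  have V: "range c = V"
    using cyclic_seq_card[OF c] cyclic_seq_in_V[OF c] finite_V by (intro card_subset_eq) auto
  have "u \<in> range c" using uv arc_in_V V by auto
  then obtain i where i: "u = c i" by auto
  obtain x where x: "E u x" "x \<noteq> c (i + 1)" using uv by metis
  have "x \<in> range c" using x arc_in_V V by auto
  then obtain j where j: "i + 1 \<le> j" "j < i + 1 + card V" "x = c j"
    by (rule cyclic_seq_position[OF c])
  have "j \<noteq> i + 1" using x j by auto
  define g where "g = j - i - 1"
  have g: "i + g + 1 = j" "0 < g" "g < card V" using j \<open>j \<noteq> i + 1\<close> by (auto simp: g_def)
  obtain ws' where "closed_path E ws'" "length ws' = length ([]::'a list) + card V - g"
  proof (rule closed_path_bypass[OF c g(3), of "[]" i])
    show "successively E (c i # [] @ [c (i + g + 1)])" using x i j g by simp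
  qed auto
  then show ?thesis using g by (intro that[of ws']) auto
qed

lemma balanced_complete_bipartite_if_no_almost_spanning_cycle:
  assumes "closed_path E ws" "length ws < card V"
    and none: "\<And>ws. closed_path E ws \<Longrightarrow> length ws \<noteq> card V - 1"
  shows "balanced_complete_bipartite V E"
proof -
  define L where "L = {length ws |ws. closed_path E ws \<and> length ws < card V}"
  have L: "finite L" "L \<noteq> {}"
    using assms(1,2) by (auto simp: L_def intro: finite_subset[of _ "{..<card V}"])
  then have "Max L \<in> L" by (rule Max_in)
  then obtain us where us: "closed_path E us" "length us = Max L" "Max L < card V"
    by (auto simp: L_def)
  have "Max L \<noteq> card V - 1" using none[OF us(1)] us(2) by simp
  then have "Max L + 2 \<le> card V" using us(3) by linarith
  then interpret longest_nonspanning_cycle V E "Max L"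
    using L(1) by unfold_locales (auto simp: L_def intro!: Max_ge)
  show ?thesis
    using closed_path_imp_cyclic_seq[OF us(1)] us(2) balanced_complete_bipartite_if_cycle by metis
qed

end

section \<open>Transfer to digraphs\<close>

lemma (in digraph) out_degree_eq_outdeg:
  "out_degree G x = outdeg (\<lambda>u v. u \<rightarrow>\<^bsub>G\<^esub> v) x"
proof -
  have "inj_on (head G) (out_arcs G x)"
    by (rule inj_onI) (auto simp: out_arcs_def arc_to_ends_def intro: no_multi_arcs)
  moreover have "head G ` out_arcs G x = {v. x \<rightarrow>\<^bsub>G\<^esub> v}"
    by (auto simp: out_arcs_def arcs_ends_conv)
  ultimately show ?thesis 
    using card_image[of "head G" "out_arcs G x"] by (simp add: out_degree_def outdeg_def)
qed

lemma (in digraph) in_degree_eq_indeg: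
  "in_degree G x = indeg (\<lambda>u v. u \<rightarrow>\<^bsub>G\<^esub> v) x"
proof -
  have "inj_on (tail G) (in_arcs G x)"
    by (rule inj_onI) (auto simp: in_arcs_def arc_to_ends_def intro: no_multi_arcs)
  moreover have "tail G ` in_arcs G x = {v. v \<rightarrow>\<^bsub>G\<^esub> x}"
    by (auto simp: in_arcs_def arcs_ends_conv)
  ultimately show ?thesis 
    using card_image[of "tail G" "in_arcs G x"] by (simp add: in_degree_def indeg_def)
qed

lemma (in wf_digraph) successively_imp_awalk:
  assumes "successively (\<lambda>u v. u \<rightarrow>\<^bsub>G\<^esub> v) ws" "ws \<noteq> []" "hd ws \<in> verts G"
  shows "\<exists>p. awalk (hd ws) p (last ws) \<and> awalk_verts (hd ws) p = ws"
  using assms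
proof (induction ws rule: induct_list012)
  case (2 x)
  then show ?case by (intro exI[of _ "[]"]) (simp add: awalk_Nil_iff)
next
  case (3 x y zs)
  then have "x \<rightarrow>\<^bsub>G\<^esub> y" by simp
  then obtain e where e: "e \<in> arcs G" "tail G e = x" "head G e = y" by auto
  moreover obtain p where "awalk y p (last (y # zs))" "awalk_verts y p = y # zs"
    using 3 e by auto
  ultimately show ?case by (intro exI[of _ "e # p"]) (auto simp: awalk_Cons_iff)
qed simp

lemma (in wf_digraph) closed_path_imp_has_cycle_of_length:
  assumes "closed_path (\<lambda>u v. u \<rightarrow>\<^bsub>G\<^esub> v) ws"
  shows "has_cycle_of_length G (length ws)"
proof -
  have ws: "ws \<noteq> []" "distinct ws" "successively (\<lambda>u v. u \<rightarrow>\<^bsub>G\<^esub> v) (ws @ [hd ws])"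
    using assms by (auto simp: closed_path_def)
  have "last ws \<rightarrow>\<^bsub>G\<^esub> hd ws" using ws by (simp add: successively_append_iff)
  then have "hd (ws @ [hd ws]) \<in> verts G" using ws(1) by (simp add: adj_in_verts)
  then obtain p where p: "awalk (hd ws) p (hd ws)" "awalk_verts (hd ws) p = ws @ [hd ws]"
    using successively_imp_awalk[OF ws(3)] ws(1) by auto
  have len: "length p = length ws" using p(2) length_awalk_verts[of "hd ws" p] by simp
  have "distinct (tl (awalk_verts (hd ws) p))" using ws(1,2) p(2) by (cases ws) auto
  then have "cycle p" unfolding cycle_def using p(1) len ws(1) by auto
  then show ?thesis using len by (auto simp: has_cycle_of_length_def)
qed

text \<open>
  With out-degrees at most one there are at most as many arcs as vertices, so the arcs of a spanning
  cycle are all there is.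
\<close>

lemma (in digraph) is_directed_cycle_if_functional:
  assumes "has_cycle_of_length G (card (verts G))"
    and functional: "\<And>u v w. u \<rightarrow>\<^bsub>G\<^esub> v \<Longrightarrow> u \<rightarrow>\<^bsub>G\<^esub> w \<Longrightarrow> v = w"
  shows "is_directed_cycle G (card (verts G))"
proof -
  obtain p where p: "cycle p" "length p = card (verts G)"
    using assms by (auto simp: has_cycle_of_length_def)
  then obtain u where "awalk u p u" "distinct p" unfolding cycle_conv by auto
  then have sub: "set p \<subseteq> arcs G" and card_p: "card (set p) = card (verts G)"
    using p(2) by (auto simp: awalk_def distinct_card)
  have inj: "inj_on (tail G) (arcs G)"
  proof (rule inj_onI)
    fix e f assume ef: "e \<in> arcs G" "f \<in> arcs G" "tail G e = tail G f"
    then have "tail G e \<rightarrow>\<^bsub>G\<^esub> head G e" "tail G e \<rightarrow>\<^bsub>G\<^esub> head G f"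
      by (metis in_arcs_imp_in_arcs_ends)+
    then have "head G e = head G f" by (rule functional)
    then show "e = f" using ef by (intro no_multi_arcs) (auto simp: arc_to_ends_def)
  qed
  have "card (arcs G) = card (tail G ` arcs G)" using inj by (simp add: card_image)
  also have "\<dots> \<le> card (verts G)" by (rule card_mono) auto
  finally have "card (arcs G) \<le> card (verts G)" .
  then have "set p = arcs G" using sub card_p by (intro card_seteq) auto
  moreover have "tail G ` set p = verts G"
    using sub card_p inj by (intro card_subset_eq) (auto simp: card_image inj_on_subset)
  ultimately show ?thesis using p by (auto simp: is_directed_cycle_def)
qed

lemma (in digraph) digraph_iso_bipartite_K:
  assumes "balanced_complete_bipartite (verts G) (\<lambda>u v. u \<rightarrow>\<^bsub>G\<^esub> v)"
  shows "even (card (verts G))"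
    "digraph_iso G (with_proj (bipartite_K (card (verts G) div 2) (card (verts G) div 2)))"
proof -
  obtain X Y where V: "verts G = X \<union> Y" and disj: "X \<inter> Y = {}" and card: "card X = card Y"
    and arcs: "\<And>u v. u \<rightarrow>\<^bsub>G\<^esub> v \<longleftrightarrow> u \<in> X \<and> v \<in> Y \<or> u \<in> Y \<and> v \<in> X"
    using assms unfolding balanced_complete_bipartite_def by blast
  define k where "k = card X"
  have fin: "finite X" "finite Y" using V finite_verts by (metis finite_Un)+
  then have n: "card (verts G) = 2 * k" using V disj card by (simp add: card_Un_disjoint k_def)
  then show "even (card (verts G))" by simp
  obtain f h where f: "bij_betw f X {..<k}" and h: "bij_betw h Y {..<k}"
    using ex_bij_betw_finite_nat[OF fin(1)] ex_bij_betw_finite_nat[OF fin(2)] card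
    by (auto simp: k_def lessThan_atLeast0)
  define i where "i v = (if v \<in> X then Inl (f v) else Inr (h v))" for v
  have iX: "i ` X = Inl ` {..<k}" using f by (auto simp: i_def bij_betw_def)
  have "i ` Y = Inr ` (h ` Y)"
    unfolding image_image using disj by (intro image_cong) (auto simp: i_def)
  then have iY: "i ` Y = Inr ` {..<k}" using h by (simp add: bij_betw_def)
  have inj: "inj_on i (verts G)"
    using f h disj by (auto simp: V i_def inj_on_def bij_betw_def)
  define \<phi> where "\<phi> = \<lparr>iso_verts = i, iso_arcs = (\<lambda>e. (i (tail G e), i (head G e))),
    iso_head = snd, iso_tail = fst\<rparr>"
  have "inj_on (\<lambda>e. (i (tail G e), i (head G e))) (arcs G)"
  proof (rule inj_onI)
    fix d e assume *: "d \<in> arcs G" "e \<in> arcs G"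
      "(i (tail G d), i (head G d)) = (i (tail G e), i (head G e))"
    then have "tail G d = tail G e" "head G d = head G e"
      using inj by (auto dest: inj_onD)
    then show "d = e" using * by (intro no_multi_arcs) (auto simp: arc_to_ends_def)
  qed
  then have iso: "digraph_isomorphism \<phi>"
    using inj wf_digraph by (auto simp: digraph_isomorphism_def \<phi>_def)
  have ends: "arcs_ends G = X \<times> Y \<union> Y \<times> X" using arcs by auto
  have "(\<lambda>e. (i (tail G e), i (head G e))) ` arcs G = (\<lambda>(u, v). (i u, i v)) ` arcs_ends G"
    by (auto simp: arcs_ends_conv image_image)
  also have "\<dots> = (i ` X) \<times> (i ` Y) \<union> (i ` Y) \<times> (i ` X)"
    unfolding ends image_Un image_paired_Times ..
  finally have "with_proj (bipartite_K k k) = app_iso \<phi> G"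
    by (simp add: with_proj_def app_iso_def bipartite_K_def \<phi>_def V image_Un iX iY)
  then show "digraph_iso G (with_proj (bipartite_K (card (verts G) div 2) (card (verts G) div 2)))"
    using iso n by (auto simp: digraph_iso_def)
qed

theorem theorem2:
  fixes D :: "('a, 'b) pre_digraph" and n :: nat
  assumes "digraph D"
    and "strongly_connected D"
    and "n = card (verts D)"
    and "n \<ge> 4"
    and "\<not> is_directed_cycle D n"
    and "\<forall>x \<in> verts D. \<forall>y \<in> verts D.
           x \<noteq> y \<and> \<not> adjacent D x y \<and> (common_out_neighbour D x y \<or> common_in_neighbour D x y)
           \<longrightarrow> min (out_degree D x + in_degree D y) (in_degree D x + out_degree D y) \<ge> n"
  shows "has_cycle_of_length D (n - 1)
    \<or> (even n \<and> digraph_iso D (with_proj (bipartite_K (n div 2) (n div 2))))"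
proof -
  interpret digraph D by fact
  let ?E = "\<lambda>u v. u \<rightarrow>\<^bsub>D\<^esub> v"
  interpret degree_sum_digraph "verts D" ?E
  proof
    show "?E\<^sup>*\<^sup>* u v" if "u \<in> verts D" "v \<in> verts D" for u v
    proof -
      have "u \<rightarrow>\<^sup>*\<^bsub>D\<^esub> v" using assms(2) that by (auto simp: strongly_connected_def)
      then show ?thesis 
        by (induction rule: converse_reachable_induct)
          (auto intro: converse_rtranclp_into_rtranclp)
    qed
    show "\<not> ?E u u" for u using adj_not_same by blast
    show "card (verts D) \<le> outdeg ?E x + indeg ?E y"
      if "x \<noteq> y" "\<not> ?E x y" "\<not> ?E y x" "(\<exists>z. ?E x z \<and> ?E y z) \<or> (\<exists>z. ?E z x \<and> ?E z y)" for x y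
    proof -
      have "x \<in> verts D" "y \<in> verts D" using that(4) adj_in_verts by blast+
      then show ?thesis
        using assms(3,6) that
        by (auto simp: adjacent_def common_out_neighbour_def common_in_neighbour_def
            out_degree_eq_outdeg in_degree_eq_indeg)
    qed
  qed (auto simp: adj_in_verts)
  have "\<exists>ws. closed_path ?E ws \<and> length ws < n"
  proof (rule ccontr)
    assume none: "\<not> ?thesis"
    obtain ws where ws: "closed_path ?E ws"
      using exists_closed_path assms(3,4) by auto
    then have len: "length ws = n" using none closed_path_length_le assms(3) by (metis le_neq_implies_less)
    then have "has_cycle_of_length D (card (verts D))"
      using closed_path_imp_has_cycle_of_length[OF ws] assms(3) by simp
    moreover have "v = w" if "?E u v" "?E u w" for u v w
      using shorter_closed_path[OF ws _ that] none len assms(3) by metis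
    ultimately show False using is_directed_cycle_if_functional assms(3,5) by blast
  qed
  then obtain ws where ws: "closed_path ?E ws" "length ws < card (verts D)" using assms(3) by auto
  show ?thesis
  proof (cases "has_cycle_of_length D (n - 1)")
    case False
    then have "balanced_complete_bipartite (verts D) ?E"
      using closed_path_imp_has_cycle_of_length assms(3)
      by (intro balanced_complete_bipartite_if_no_almost_spanning_cycle[OF ws]) metis
    then show ?thesis using digraph_iso_bipartite_K assms(3) by simp
  qed simp
qed

end
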